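(* Let $I\subseteq\mathbb{R}$ be an interval with interior $I^\circ$, let $a,b\in I^\circ$ with $a<b$, and let $f:I\to\mathbb{R}$ be differentiable on $I^\circ$. Let $P: a=x_0<x_1<\dots<x_n=b$ be a partition of $[a,b]$, and let $g:[a,b]\to[0,\infty)$ be such that, for each $i\in\{0,\dots,n-1\}$, the restriction of $g$ to $[x_i,x_{i+1}]$ is differentiable and symmetric to $\frac{x_i+x_{i+1}}{2}$. Let $h(t)=t^k$, and suppose that for each $i\in\{0,\dots,n-1\}$ the function $|f'|$ is $h$-convex on $[x_i,x_{i+1}]$. Then $$|E(f,g,P)|\leq\frac{1}{k+1}\sum_{i=0}^{n-1}(x_{i+1}-x_i)\Big[|f'(x_i)|+|f'(x_{i+1})|\Big]\int_{\frac{x_i+x_{i+1}}{2}}^{x_{i+1}}\left[\Big(\frac{x_{i+1}-x}{x_{i+1}-x_i}\Big)^{k+1}-\Big(\frac{x-x_i}{x_{i+1}-x_i}\Big)^{k+1}+1\right]g(x)\,dx.$$ If $k=1$ and $g\equiv1$, this gives the (previously known) inequality $$|E(f,P)|\leq\frac18\sum_{i=0}^{n-1}\Big[|f'(x_i)|+|f'(x_{i+1})|\Big](x_{i+1}-x_i)^2.$$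
   Context: A function $g$ on $[c,d]$ is symmetric to $\frac{c+d}{2}$ if $g(x)=g(c+d-x)$ for all $x\in[c,d]$. For a function $h:[0,1]\to[0,\infty)$ with $h\not\equiv0$, a nonnegative function $\varphi:J\to[0,\infty)$ on an interval $J$ is $h$-convex if for all $x,y\in J$ and all $\lambda\in[0,1]$, $\varphi(\lambda x+(1-\lambda)y)\le h(\lambda)\varphi(x)+h(1-\lambda)\varphi(y)$. The trapezoidal form $T(f,g,P)$ and the associated approximation error $E(f,g,P)$ are given by $$T(f,g,P)=\sum_{i=0}^{n-1}\frac{f(x_i)+f(x_{i+1})}{2}\int_{x_i}^{x_{i+1}}g(x)\,dx,\qquad \int_a^b f(x)g(x)\,dx=T(f,g,P)+E(f,g,P),$$ and $E(f,P)$ denotes $E(f,g,P)$ for $g\equiv1$. *)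

theory Defs
  imports "HOL-Analysis.Analysis"
begin

definition symmetric_about_midpoint :: "(real \<Rightarrow> real) \<Rightarrow> real \<Rightarrow> real \<Rightarrow> bool" where
  "symmetric_about_midpoint g c d \<longleftrightarrow> (\<forall>t\<in>{c..d}. g t = g (c + d - t))"

text \<open>The first two conjuncts are the standing assumption that \<open>h\<close> is a function from
  \<open>[0,1]\<close> to \<open>[0,\<infinity>)\<close> that does not vanish identically.\<close>

definition h_convex_on :: "(real \<Rightarrow> real) \<Rightarrow> real set \<Rightarrow> (real \<Rightarrow> real) \<Rightarrow> bool" where
  "h_convex_on h J \<phi> \<longleftrightarrow>
     (\<forall>t\<in>{0..1}. 0 \<le> h t) \<and> (\<exists>t\<in>{0..1}. h t \<noteq> 0) \<and>
     is_interval J \<and> (\<forall>u\<in>J. 0 \<le> \<phi> u) \<and>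
     (\<forall>u\<in>J. \<forall>v\<in>J. \<forall>l\<in>{0..1}.
        \<phi> (l * u + (1 - l) * v) \<le> h l * \<phi> u + h (1 - l) * \<phi> v)"

text \<open>The function \<open>t \<mapsto> t\<^sup>k\<close> on \<open>[0,1]\<close> for a real exponent \<open>k \<ge> 0\<close>. The case distinction
  only restores the usual \<open>0\<^sup>0 = 1\<close>, since \<open>0 powr 0 = 0\<close>.\<close>

definition power_fun :: "real \<Rightarrow> real \<Rightarrow> real" where
  "power_fun k t = (if k = 0 then 1 else t powr k)"

definition partition_points :: "real \<Rightarrow> real \<Rightarrow> nat \<Rightarrow> (nat \<Rightarrow> real) \<Rightarrow> bool" where
  "partition_points a b n x \<longleftrightarrow> x 0 = a \<and> x n = b \<and> (\<forall>i<n. x i < x (Suc i))"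

definition trapezoidal :: "(real \<Rightarrow> real) \<Rightarrow> (real \<Rightarrow> real) \<Rightarrow> nat \<Rightarrow> (nat \<Rightarrow> real) \<Rightarrow> real" where
  "trapezoidal f g n x =
     (\<Sum>i<n. (f (x i) + f (x (Suc i))) / 2 * integral {x i..x (Suc i)} g)"

definition trapezoidal_error ::
    "(real \<Rightarrow> real) \<Rightarrow> (real \<Rightarrow> real) \<Rightarrow> nat \<Rightarrow> (nat \<Rightarrow> real) \<Rightarrow> real" where
  "trapezoidal_error f g n x =
     integral {x 0..x n} (\<lambda>t. f t * g t) - trapezoidal f g n x"

end

theory Submission
  imports Defs
begin

text \<open>
  On a single cell \<open>[c, d]\<close> of length \<open>L\<close> with midpoint \<open>m\<close>, the symmetry of \<open>g\<close> folds every integral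
  against \<open>g\<close> onto the right half, so that the trapezoidal error becomes
  \<open>\<integral>\<^bsub>m\<^esub>\<^bsup>d\<^esup> (f t + f (c + d - t) - f c - f d) g t dt\<close>. As \<open>g \<ge> 0\<close>, it is enough to bound the
  bracket pointwise. It consists of two increments of \<open>f\<close>, over \<open>[t, d]\<close> and over the reflected
  interval \<open>[c, c + d - t]\<close>.

  Writing \<open>u\<close> as a convex combination of \<open>c\<close> and \<open>d\<close>, the convexity hypothesis gives
  \<open>\<bar>f' u\<bar> \<le> ((d - u)/L)\<^sup>k \<bar>f' c\<bar> + ((u - c)/L)\<^sup>k \<bar>f' d\<bar>\<close>. The right-hand side has an
  explicit antiderivative, and its increments dominate those of \<open>f\<close>
  (lemma \<open>increment_le_power_convex\<close>). In the sum over the two reflected intervals the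
  coefficients of \<open>\<bar>f' c\<bar>\<close> and \<open>\<bar>f' d\<bar>\<close> coincide: both are \<open>L / (k + 1)\<close> times the bracket in
  the stated bound, which proves the estimate on one cell (lemma \<open>trapezoidal_error_cell\<close>). Summing over the
  partition gives the first inequality; for \<open>g \<equiv> 1\<close> and \<open>k = 1\<close> the remaining integral is \<open>L / 4\<close>.
\<close>

text \<open>
  Both \<open>B - f\<close> and \<open>B + f\<close> are increasing, where \<open>B\<close> is an antiderivative of the majorant that
  convexity gives for \<open>\<bar>f'\<bar>\<close> in terms of its values at the two endpoints. The majorant is
  the one of the whole interval \<open>[c, d]\<close> even for increments over \<open>[p, q]\<close>, so that all bounds
  involve only \<open>f' c\<close> and \<open>f' d\<close>.
\<close>

lemma increment_le_power_convex:
  fixes f f' :: "real \<Rightarrow> real"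
  assumes "c < d" and k: "0 \<le> k"
    and convex: "h_convex_on (power_fun k) {c..d} (\<lambda>t. \<bar>f' t\<bar>)"
    and deriv: "\<And>u. u \<in> {c..d} \<Longrightarrow> (f has_real_derivative f' u) (at u)"
    and "c \<le> p" "p \<le> q" "q \<le> d"
  shows "\<bar>f q - f p\<bar> \<le> (d - c) / (k + 1) *
    (\<bar>f' c\<bar> * (((d - p) / (d - c)) powr (k + 1) - ((d - q) / (d - c)) powr (k + 1)) +
     \<bar>f' d\<bar> * (((q - c) / (d - c)) powr (k + 1) - ((p - c) / (d - c)) powr (k + 1)))"
proof -
  define B where "B u = (d - c) / (k + 1) *
    (\<bar>f' d\<bar> * ((u - c) / (d - c)) powr (k + 1) - \<bar>f' c\<bar> * ((d - u) / (d - c)) powr (k + 1))" for u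
  define b where "b u = \<bar>f' c\<bar> * ((d - u) / (d - c)) powr k + \<bar>f' d\<bar> * ((u - c) / (d - c)) powr k" for u
  have f'_le: "\<bar>f' u\<bar> \<le> b u" if u: "c < u" "u < d" for u
  proof -
    define l where "l = (d - u) / (d - c)"
    have l: "0 < l" "l < 1" "1 - l = (u - c) / (d - c)"
      using u \<open>c < d\<close> by (auto simp: l_def field_simps)
    have "l * (d - c) = d - u"
      using \<open>c < d\<close> by (simp add: l_def)
    then have "l * c + (1 - l) * d = u"
      by (simp add: algebra_simps)
    moreover have "\<bar>f' (l * c + (1 - l) * d)\<bar> \<le>
        power_fun k l * \<bar>f' c\<bar> + power_fun k (1 - l) * \<bar>f' d\<bar>"
      using convex l(1,2) \<open>c < d\<close> unfolding h_convex_on_def by auto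
    moreover have "power_fun k l = ((d - u) / (d - c)) powr k"
        "power_fun k (1 - l) = ((u - c) / (d - c)) powr k"
      unfolding l(3)[symmetric] using l(1,2) by (auto simp: power_fun_def l_def)
    ultimately show ?thesis
      by (simp add: b_def mult.commute)
  qed
  have B_deriv: "(B has_real_derivative b u) (at u)" if u: "c < u" "u < d" for u
  proof -
    have pos: "0 < (u - c) / (d - c)" "0 < (d - u) / (d - c)"
      using u \<open>c < d\<close> by auto
    have "((\<lambda>u. ((u - c) / (d - c)) powr (k + 1)) has_real_derivative
        (k + 1) * ((u - c) / (d - c)) powr (k + 1 - 1) * (1 / (d - c))) (at u)"
      by (rule DERIV_chain2[where f = "\<lambda>z. z powr (k + 1)" and g = "\<lambda>u. (u - c) / (d - c)",
            OF has_real_derivative_powr[OF pos(1)]])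
         (rule DERIV_cdivide, auto intro!: derivative_eq_intros)
    moreover have "((\<lambda>u. ((d - u) / (d - c)) powr (k + 1)) has_real_derivative
        (k + 1) * ((d - u) / (d - c)) powr (k + 1 - 1) * (- 1 / (d - c))) (at u)"
      by (rule DERIV_chain2[where f = "\<lambda>z. z powr (k + 1)" and g = "\<lambda>u. (d - u) / (d - c)",
            OF has_real_derivative_powr[OF pos(2)]])
         (rule DERIV_cdivide, auto intro!: derivative_eq_intros)
    ultimately have "(B has_real_derivative (d - c) / (k + 1) *
        (\<bar>f' d\<bar> * ((k + 1) * ((u - c) / (d - c)) powr (k + 1 - 1) * (1 / (d - c))) -
         \<bar>f' c\<bar> * ((k + 1) * ((d - u) / (d - c)) powr (k + 1 - 1) * (- 1 / (d - c))))) (at u)"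
      unfolding B_def by (intro DERIV_cmult DERIV_diff)
    moreover have "(d - c) / (k + 1) *
        (\<bar>f' d\<bar> * ((k + 1) * P * (1 / (d - c))) - \<bar>f' c\<bar> * ((k + 1) * Q * (- 1 / (d - c)))) =
        \<bar>f' c\<bar> * Q + \<bar>f' d\<bar> * P" for P Q
      using k \<open>c < d\<close> by (simp add: divide_simps) (simp add: algebra_simps)
    ultimately show ?thesis
      by (simp add: b_def)
  qed
  have f_cont: "continuous_on {p..q} f"
    by (intro continuous_at_imp_continuous_on ballI, rule DERIV_isCont[OF deriv])
       (use assms(5-7) in auto)
  have nonneg: "0 \<le> (u - c) / (d - c)" "0 \<le> (d - u) / (d - c)" if "u \<in> {p..q}" for u
    using that \<open>c < d\<close> assms(5-7) by auto
  have powers_cont: "continuous_on {p..q} (\<lambda>u. ((u - c) / (d - c)) powr (k + 1))"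
      "continuous_on {p..q} (\<lambda>u. ((d - u) / (d - c)) powr (k + 1))"
    by (rule continuous_on_powr'; use nonneg k \<open>c < d\<close> in \<open>force intro!: continuous_intros\<close>)+
  have B_cont: "continuous_on {p..q} B"
    unfolding B_def by (intro continuous_on_mult continuous_on_diff continuous_on_const powers_cont)
  have "(\<lambda>u. B u - f u) p \<le> (\<lambda>u. B u - f u) q"
  proof (rule DERIV_nonneg_imp_increasing_open[OF \<open>p \<le> q\<close>])
    \<comment> \<open>The open-interval version is needed: \<open>b\<close> need not be the derivative of \<open>B\<close> at \<open>c\<close> and \<open>d\<close>,
      where one of the two bases vanishes.\<close>
    fix u assume "p < u" "u < q"
    then have u: "c < u" "u < d" using assms(5-7) by auto
    then have "((\<lambda>u. B u - f u) has_real_derivative b u - f' u) (at u)"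
      by (intro DERIV_diff B_deriv deriv) auto
    with f'_le[OF u] show "\<exists>y. ((\<lambda>u. B u - f u) has_real_derivative y) (at u) \<and> 0 \<le> y"
      by force
  qed (intro continuous_intros f_cont B_cont)
  moreover have "(\<lambda>u. B u + f u) p \<le> (\<lambda>u. B u + f u) q"
  proof (rule DERIV_nonneg_imp_increasing_open[OF \<open>p \<le> q\<close>])
    fix u assume "p < u" "u < q"
    then have u: "c < u" "u < d" using assms(5-7) by auto
    then have "((\<lambda>u. B u + f u) has_real_derivative b u + f' u) (at u)"
      by (intro DERIV_add B_deriv deriv) auto
    with f'_le[OF u] show "\<exists>y. ((\<lambda>u. B u + f u) has_real_derivative y) (at u) \<and> 0 \<le> y"
      by force
  qed (intro continuous_intros f_cont B_cont)
  ultimately have "\<bar>f q - f p\<bar> \<le> B q - B p"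
    by auto
  also have "B q - B p = (d - c) / (k + 1) *
    (\<bar>f' c\<bar> * (((d - p) / (d - c)) powr (k + 1) - ((d - q) / (d - c)) powr (k + 1)) +
     \<bar>f' d\<bar> * (((q - c) / (d - c)) powr (k + 1) - ((p - c) / (d - c)) powr (k + 1)))"
    by (simp add: B_def right_diff_distrib distrib_left)
  finally show ?thesis .
qed

lemma integral_fold_midpoint:
  fixes F :: "real \<Rightarrow> real"
  assumes "c \<le> d" and cont: "continuous_on {c..d} F"
  shows "integral {c..d} F = integral {(c + d) / 2..d} (\<lambda>t. F t + F (c + d - t))"
proof -
  define m where "m = (c + d) / 2"
  have m: "c \<le> m" "m \<le> d" "c + d - m = m" using \<open>c \<le> d\<close> by (auto simp: m_def field_simps)
  have right: "F integrable_on {m..d}" and left: "F integrable_on {c..m}"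
    using m by (auto intro!: integrable_continuous_real continuous_on_subset[OF cont])
  have "(F has_integral integral {c..m} F) (cbox c m)"
    using left by (simp add: integrable_integral)
  from has_integral_affinity[OF this, of "-1" "c + d"]
  have reflected: "((\<lambda>t. F (c + d - t)) has_integral integral {c..m} F) {m..d}"
    using m \<open>c \<le> d\<close> by (simp add: image_affinity_atLeastAtMost_diff minus_mult_commute m_def field_simps)
  have "integral {c..d} F = integral {c..m} F + integral {m..d} F"
    using m cont by (simp add: Henstock_Kurzweil_Integration.integral_combine integrable_continuous_real)
  also have "\<dots> = integral {m..d} (\<lambda>t. F t + F (c + d - t))"
    using has_integral_add[OF integrable_integral[OF right] reflected]
    by (simp add: integral_unique)
  finally show ?thesis by (simp add: m_def)
qed

text \<open>
  Folding at the midpoint turns the error into an integral of \<open>e t * g t\<close> over the right half, where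
  \<open>e t\<close> is the difference of the increments of \<open>f\<close> over \<open>[c, c + d - t]\<close> and \<open>[t, d]\<close>. Reflection
  exchanges the roles of \<open>\<bar>f' c\<bar>\<close> and \<open>\<bar>f' d\<bar>\<close> in the bounds of these increments, which is
  why only the sum of the two appears in the result.
\<close>

lemma trapezoidal_error_cell:
  fixes f f' g :: "real \<Rightarrow> real"
  assumes "c < d" and k: "0 \<le> k"
    and convex: "h_convex_on (power_fun k) {c..d} (\<lambda>t. \<bar>f' t\<bar>)"
    and deriv: "\<And>u. u \<in> {c..d} \<Longrightarrow> (f has_real_derivative f' u) (at u)"
    and g_cont: "continuous_on {c..d} g"
    and g_nonneg: "\<And>t. t \<in> {c..d} \<Longrightarrow> 0 \<le> g t"
    and g_sym: "symmetric_about_midpoint g c d"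
  shows "\<bar>integral {c..d} (\<lambda>t. f t * g t) - (f c + f d) / 2 * integral {c..d} g\<bar> \<le>
    1 / (k + 1) * ((d - c) * (\<bar>f' c\<bar> + \<bar>f' d\<bar>) * integral {(c + d) / 2..d}
      (\<lambda>t. (((d - t) / (d - c)) powr (k + 1) - ((t - c) / (d - c)) powr (k + 1) + 1) * g t))"
proof -
  define m where "m = (c + d) / 2"
  define w where "w t = ((d - t) / (d - c)) powr (k + 1) - ((t - c) / (d - c)) powr (k + 1) + 1" for t
  define C where "C = (d - c) / (k + 1) * (\<bar>f' c\<bar> + \<bar>f' d\<bar>)"
  define e where "e t = f t + f (c + d - t) - f c - f d" for t
  have m: "c \<le> m" "m \<le> d" "\<And>t. t \<in> {m..d} \<Longrightarrow> t \<in> {c..d} \<and> c + d - t \<in> {c..d}"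
    using \<open>c < d\<close> by (auto simp: m_def field_simps)
  have f_cont: "continuous_on {c..d} f"
    by (intro continuous_at_imp_continuous_on ballI) (rule DERIV_isCont[OF deriv])
  have f_cont_half: "continuous_on {m..d} f" "continuous_on {m..d} (\<lambda>t. f (c + d - t))"
    using m(3) by (auto intro!: continuous_on_subset[OF f_cont] continuous_on_compose2[OF f_cont] continuous_intros)
  have g_cont_half: "continuous_on {m..d} g"
    using m(3) by (auto intro!: continuous_on_subset[OF g_cont])
  have g_refl: "g (c + d - t) = g t" if "t \<in> {m..d}" for t
    using g_sym m(3)[OF that] unfolding symmetric_about_midpoint_def by metis
  have fg: "integral {c..d} (\<lambda>t. f t * g t) = integral {m..d} (\<lambda>t. (f t + f (c + d - t)) * g t)"
    unfolding integral_fold_midpoint[OF less_imp_le[OF \<open>c < d\<close>] continuous_on_mult[OF f_cont g_cont]]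
    unfolding m_def[symmetric]
    by (rule integral_cong) (simp add: g_refl algebra_simps)
  have "integral {c..d} g = integral {m..d} (\<lambda>t. 2 * g t)"
    unfolding integral_fold_midpoint[OF less_imp_le[OF \<open>c < d\<close>] g_cont] m_def[symmetric]
    by (rule integral_cong) (simp add: g_refl)
  then have "(f c + f d) / 2 * integral {c..d} g = integral {m..d} (\<lambda>t. (f c + f d) * g t)"
    by simp
  with fg have "integral {c..d} (\<lambda>t. f t * g t) - (f c + f d) / 2 * integral {c..d} g =
      integral {m..d} (\<lambda>t. (f t + f (c + d - t)) * g t - (f c + f d) * g t)"
    by (subst integral_diff)
       (auto intro!: integrable_continuous_real continuous_intros f_cont_half g_cont_half)
  also have "\<dots> = integral {m..d} (\<lambda>t. e t * g t)"
    by (rule integral_cong) (simp add: e_def algebra_simps)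
  finally have error: "integral {c..d} (\<lambda>t. f t * g t) - (f c + f d) / 2 * integral {c..d} g =
      integral {m..d} (\<lambda>t. e t * g t)" .
  have e_le: "\<bar>e t\<bar> \<le> C * w t" if t: "t \<in> {m..d}" for t
  proof -
    let ?s = "c + d - t"
    have s: "t \<le> d" "c \<le> t" "c \<le> ?s" "?s \<le> d" using m(3)[OF t] by auto
    have "\<bar>e t\<bar> \<le> \<bar>f d - f t\<bar> + \<bar>f ?s - f c\<bar>"
      by (simp add: e_def)
    also have "\<dots> \<le> C * w t"
    proof -
      define P where "P = ((d - t) / (d - c)) powr (k + 1)"
      define Q where "Q = ((t - c) / (d - c)) powr (k + 1)"
      have refl: "d - ?s = t - c" "?s - c = d - t" by auto
      have "\<bar>f d - f t\<bar> \<le> (d - c) / (k + 1) * (\<bar>f' c\<bar> * P + \<bar>f' d\<bar> * (1 - Q))"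
        using increment_le_power_convex[OF \<open>c < d\<close> k convex deriv, of t d] s \<open>c < d\<close>
        by (simp add: P_def Q_def)
      moreover have "\<bar>f ?s - f c\<bar> \<le> (d - c) / (k + 1) * (\<bar>f' c\<bar> * (1 - Q) + \<bar>f' d\<bar> * P)"
        using increment_le_power_convex[OF \<open>c < d\<close> k convex deriv, of c ?s] s \<open>c < d\<close>
        unfolding refl by (simp add: P_def Q_def)
      ultimately have "\<bar>f d - f t\<bar> + \<bar>f ?s - f c\<bar> \<le>
          (d - c) / (k + 1) * (\<bar>f' c\<bar> * P + \<bar>f' d\<bar> * (1 - Q)) +
          (d - c) / (k + 1) * (\<bar>f' c\<bar> * (1 - Q) + \<bar>f' d\<bar> * P)"
        by (rule add_mono)
      also have "\<dots> = (d - c) / (k + 1) * ((\<bar>f' c\<bar> + \<bar>f' d\<bar>) * (P - Q + 1))"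
        unfolding distrib_left[symmetric] by (simp add: algebra_simps)
      finally show ?thesis by (simp add: C_def w_def P_def Q_def)
    qed
    finally show ?thesis .
  qed
  have w_cont: "continuous_on {m..d} w"
    unfolding w_def using k \<open>c < d\<close> m by (intro continuous_intros continuous_on_powr') auto
  have "\<bar>integral {m..d} (\<lambda>t. e t * g t)\<bar> \<le> integral {m..d} (\<lambda>t. C * (w t * g t))"
    unfolding real_norm_def[symmetric]
  proof (rule integral_norm_bound_integral)
    show "norm (e t * g t) \<le> C * (w t * g t)" if "t \<in> {m..d}" for t
      using mult_right_mono[OF e_le[OF that], of "g t"] g_nonneg m(3)[OF that]
      by (simp add: abs_mult algebra_simps)
  qed (auto simp: e_def intro!: integrable_continuous_real continuous_intros
        f_cont_half g_cont_half w_cont)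
  also have "\<dots> = 1 / (k + 1) * ((d - c) * (\<bar>f' c\<bar> + \<bar>f' d\<bar>) * integral {m..d} (\<lambda>t. w t * g t))"
    by (simp add: C_def)
  finally show ?thesis
    unfolding error m_def w_def .
qed

lemma has_integral_partition:
  fixes F :: "real \<Rightarrow> real"
  assumes "\<And>i. i < n \<Longrightarrow> x i \<le> x (Suc i)"
    and "\<And>i. i < n \<Longrightarrow> F integrable_on {x i..x (Suc i)}"
  shows "x 0 \<le> x n \<and> (F has_integral (\<Sum>i<n. integral {x i..x (Suc i)} F)) {x 0..x n}"
  using assms
proof (induction n)
  case (Suc n)
  then have IH: "x 0 \<le> x n" "(F has_integral (\<Sum>i<n. integral {x i..x (Suc i)} F)) {x 0..x n}"
    by auto
  have last: "x n \<le> x (Suc n)" "(F has_integral integral {x n..x (Suc n)} F) {x n..x (Suc n)}"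
    using Suc.prems by (auto intro: integrable_integral)
  show ?case
    using has_integral_combine[OF IH(1) last(1) IH(2) last(2)] IH(1) last(1) by simp
qed auto

lemma trapezoidal_error_partition:
  fixes f f' g :: "real \<Rightarrow> real"
  assumes k: "0 \<le> k" and mono: "\<And>i. i < n \<Longrightarrow> x i < x (Suc i)"
    and convex: "\<And>i. i < n \<Longrightarrow> h_convex_on (power_fun k) {x i..x (Suc i)} (\<lambda>t. \<bar>f' t\<bar>)"
    and deriv: "\<And>i u. i < n \<Longrightarrow> u \<in> {x i..x (Suc i)} \<Longrightarrow> (f has_real_derivative f' u) (at u)"
    and g_cont: "\<And>i. i < n \<Longrightarrow> continuous_on {x i..x (Suc i)} g"
    and g_nonneg: "\<And>i t. i < n \<Longrightarrow> t \<in> {x i..x (Suc i)} \<Longrightarrow> 0 \<le> g t"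
    and g_sym: "\<And>i. i < n \<Longrightarrow> symmetric_about_midpoint g (x i) (x (Suc i))"
  shows "\<bar>trapezoidal_error f g n x\<bar> \<le>
      1 / (k + 1) * (\<Sum>i<n. (x (Suc i) - x i) * (\<bar>f' (x i)\<bar> + \<bar>f' (x (Suc i))\<bar>) *
        integral {(x i + x (Suc i)) / 2..x (Suc i)}
          (\<lambda>t. (((x (Suc i) - t) / (x (Suc i) - x i)) powr (k + 1)
              - ((t - x i) / (x (Suc i) - x i)) powr (k + 1) + 1) * g t))"
proof -
  have "(\<lambda>t. f t * g t) integrable_on {x i..x (Suc i)}" if i: "i < n" for i
  proof -
    have "continuous_on {x i..x (Suc i)} f"
      by (intro continuous_at_imp_continuous_on ballI) (rule DERIV_isCont[OF deriv[OF i]])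
    then show ?thesis
      by (intro integrable_continuous_real continuous_on_mult g_cont i)
  qed
  then have "integral {x 0..x n} (\<lambda>t. f t * g t) =
      (\<Sum>i<n. integral {x i..x (Suc i)} (\<lambda>t. f t * g t))"
    using has_integral_partition[of n x "\<lambda>t. f t * g t"] mono
    by (simp add: integral_unique less_imp_le)
  then have "trapezoidal_error f g n x = (\<Sum>i<n. integral {x i..x (Suc i)} (\<lambda>t. f t * g t) -
      (f (x i) + f (x (Suc i))) / 2 * integral {x i..x (Suc i)} g)"
    by (simp add: trapezoidal_error_def trapezoidal_def sum_subtractf)
  then show ?thesis
    unfolding sum_distrib_left
    by (elim ssubst, intro order.trans[OF sum_abs] sum_mono
        trapezoidal_error_cell k mono convex deriv g_cont g_nonneg g_sym) auto
qed

text \<open>For \<open>k = 1\<close> and \<open>g \<equiv> 1\<close> the weight is the linear function \<open>2 (d - t) / (d - c)\<close>, because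
  the quadratic terms cancel.\<close>

lemma integral_weight_linear_case:
  fixes c d :: real
  assumes "c < d"
  shows "integral {(c + d) / 2..d}
      (\<lambda>t. (((d - t) / (d - c)) powr (1 + 1) - ((t - c) / (d - c)) powr (1 + 1) + 1) * 1) = (d - c) / 4"
proof -
  define m where "m = (c + d) / 2"
  have m: "c \<le> m" "m \<le> d" using assms by (auto simp: m_def)
  have weight: "(((d - t) / (d - c)) powr (1 + 1) - ((t - c) / (d - c)) powr (1 + 1) + 1) * 1 =
      2 * (d - t) / (d - c)" if "t \<in> {m..d}" for t
  proof -
    have "((d - t) / (d - c))\<^sup>2 - ((t - c) / (d - c))\<^sup>2 + 1 =
        ((d - t) / (d - c) + (t - c) / (d - c)) * ((d - t) / (d - c) - (t - c) / (d - c)) + 1"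
      by (simp add: power2_eq_square algebra_simps)
    also have "(d - t) / (d - c) + (t - c) / (d - c) = 1"
      using assms by (simp add: add_divide_distrib[symmetric])
    also have "1 * ((d - t) / (d - c) - (t - c) / (d - c)) + 1 = 2 * (d - t) / (d - c)"
      using assms by (simp add: divide_simps)
    finally show ?thesis
      using that m assms by simp
  qed
  have "((\<lambda>t. 2 * (d - t) / (d - c)) has_integral (- (d - d)\<^sup>2 / (d - c)) - (- (d - m)\<^sup>2 / (d - c))) {m..d}"
  proof (rule fundamental_theorem_of_calculus[OF m(2)])
    fix t
    have "((\<lambda>t. - (d - t)\<^sup>2 / (d - c)) has_real_derivative 2 * (d - t) / (d - c)) (at t within {m..d})"
      by (rule DERIV_cdivide) (auto intro!: derivative_eq_intros)
    then show "((\<lambda>t. - (d - t)\<^sup>2 / (d - c)) has_vector_derivative 2 * (d - t) / (d - c))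
        (at t within {m..d})"
      by (simp add: has_real_derivative_iff_has_vector_derivative)
  qed
  from integral_unique[OF this]
  have "integral {m..d} (\<lambda>t. 2 * (d - t) / (d - c)) = (d - m)\<^sup>2 / (d - c)"
    by (simp only: diff_self) simp
  also have "\<dots> = (d - c) / 4"
    using assms by (simp add: m_def field_simps power2_eq_square)
  finally have "integral {m..d} (\<lambda>t. 2 * (d - t) / (d - c)) = (d - c) / 4" .
  moreover have "integral {m..d} (\<lambda>t. (((d - t) / (d - c)) powr (1 + 1) -
      ((t - c) / (d - c)) powr (1 + 1) + 1) * 1) = integral {m..d} (\<lambda>t. 2 * (d - t) / (d - c))"
    by (rule integral_cong) (rule weight)
  ultimately show ?thesis
    unfolding m_def by (rule trans[rotated])
qed

theorem corollary3p3:
  fixes I :: "real set" and a b k :: real and f g :: "real \<Rightarrow> real"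
    and n :: nat and x :: "nat \<Rightarrow> real"
  assumes "is_interval I"
    and "a \<in> interior I" and "b \<in> interior I" and "a < b"
    and "f differentiable_on interior I"
    and "partition_points a b n x"
    and "\<forall>t\<in>{a..b}. 0 \<le> g t"
    and "\<forall>i<n. g differentiable_on {x i..x (Suc i)}"
    and "\<forall>i<n. symmetric_about_midpoint g (x i) (x (Suc i))"
    and "0 \<le> k"
    and "\<forall>i<n. h_convex_on (power_fun k) {x i..x (Suc i)} (\<lambda>t. \<bar>deriv f t\<bar>)"
  shows "\<bar>trapezoidal_error f g n x\<bar> \<le>
      1 / (k + 1) * (\<Sum>i<n. (x (Suc i) - x i) * (\<bar>deriv f (x i)\<bar> + \<bar>deriv f (x (Suc i))\<bar>) *
        integral {(x i + x (Suc i)) / 2..x (Suc i)}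
          (\<lambda>t. (((x (Suc i) - t) / (x (Suc i) - x i)) powr (k + 1)
              - ((t - x i) / (x (Suc i) - x i)) powr (k + 1) + 1) * g t))
    \<and> (k = 1 \<and> (\<forall>t\<in>{a..b}. g t = 1) \<longrightarrow>
        \<bar>trapezoidal_error f (\<lambda>_. 1) n x\<bar> \<le>
          1 / 8 * (\<Sum>i<n. (\<bar>deriv f (x i)\<bar> + \<bar>deriv f (x (Suc i))\<bar>) * (x (Suc i) - x i)\<^sup>2))"
    (is "?weighted \<and> (_ \<longrightarrow> ?unweighted)")
proof -
  have ends: "x 0 = a" "x n = b" and cell_pos: "\<And>i. i < n \<Longrightarrow> x i < x (Suc i)"
    using assms(6) by (auto simp: partition_points_def)
  have x_mono: "x i \<le> x j" if "i \<le> j" "j \<le> n" for i j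
    using that
  proof (induction j rule: dec_induct)
    case (step m)
    then show ?case using cell_pos[of m] by simp
  qed simp
  have cell: "{x i..x (Suc i)} \<subseteq> {a..b}" if "i < n" for i
    using x_mono[of 0 i] x_mono[of "Suc i" n] that ends by auto
  have "is_interval (interior I)"
    using assms(1) by (simp add: is_interval_convex_1 convex_interior)
  then have "{a..b} \<subseteq> interior I"
    using mem_is_interval_1_I[OF _ assms(2,3)] by (meson atLeastAtMost_iff subsetI)
  then have f_deriv: "(f has_real_derivative deriv f u) (at u)" if "u \<in> {a..b}" for u
    using assms(5) that
    by (metis DERIV_deriv_iff_real_differentiable differentiable_on_eq_differentiable_at
        open_interior subsetD)
  have ?weighted
  proof (rule trapezoidal_error_partition)
    show "0 \<le> k" by fact
  next
    fix i assume i: "i < n"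
    show "x i < x (Suc i)" by (rule cell_pos[OF i])
    show "h_convex_on (power_fun k) {x i..x (Suc i)} (\<lambda>t. \<bar>deriv f t\<bar>)"
      "symmetric_about_midpoint g (x i) (x (Suc i))" "continuous_on {x i..x (Suc i)} g"
      using assms(8,9,11) i by (simp_all add: differentiable_imp_continuous_on)
    show "0 \<le> g t" if "t \<in> {x i..x (Suc i)}" for t
      using that assms(7) cell[OF i] by blast
    show "(f has_real_derivative deriv f u) (at u)" if "u \<in> {x i..x (Suc i)}" for u
      using that f_deriv cell[OF i] by blast
  qed
  moreover have ?unweighted if "k = 1"
  proof -
    have "\<bar>trapezoidal_error f (\<lambda>_. 1) n x\<bar> \<le>
      1 / (1 + 1) * (\<Sum>i<n. (x (Suc i) - x i) * (\<bar>deriv f (x i)\<bar> + \<bar>deriv f (x (Suc i))\<bar>) *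
        integral {(x i + x (Suc i)) / 2..x (Suc i)}
          (\<lambda>t. (((x (Suc i) - t) / (x (Suc i) - x i)) powr (1 + 1)
              - ((t - x i) / (x (Suc i) - x i)) powr (1 + 1) + 1) * 1))"
    proof (rule trapezoidal_error_partition)
      fix i assume i: "i < n"
      show "x i < x (Suc i)" by (rule cell_pos[OF i])
      show "h_convex_on (power_fun 1) {x i..x (Suc i)} (\<lambda>t. \<bar>deriv f t\<bar>)"
        using assms(11) i that by simp
      show "(f has_real_derivative deriv f u) (at u)" if "u \<in> {x i..x (Suc i)}" for u
        using that f_deriv cell[OF i] by blast
    qed (simp_all add: symmetric_about_midpoint_def)
    also have "\<dots> = 1 / (1 + 1) * (\<Sum>i<n. (x (Suc i) - x i) *
        (\<bar>deriv f (x i)\<bar> + \<bar>deriv f (x (Suc i))\<bar>) * ((x (Suc i) - x i) / 4))"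
      using integral_weight_linear_case[OF cell_pos] by (intro arg_cong2[of _ _ _ _ "(*)"] sum.cong refl) auto
    also have "\<dots> = 1 / 8 * (\<Sum>i<n. (\<bar>deriv f (x i)\<bar> + \<bar>deriv f (x (Suc i))\<bar>) * (x (Suc i) - x i)\<^sup>2)"
      unfolding sum_distrib_left by (intro sum.cong) (auto simp: power2_eq_square field_simps)
    finally show ?thesis .
  qed
  ultimately show ?thesis by blast
qed

end
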